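(* Let $P_{\mathrm{out}}^{\mathrm{LU}}=\mathbb{P}\left(\mathrm{SNR}_{\mathrm{LU}}<\gamma_{\mathrm{th}}\right)$ be the outage probability of the link from the associated (nearest) leader satellite to the user. Then $$P_{\mathrm{out}}^{\mathrm{LU}}=\int_0^{\theta_{\max}}F_{W_{\mathrm U}}\left(\frac{\gamma_{\mathrm{th}}\,r_{\mathrm{LU}}^2(\theta)}{\xi_{\mathrm{LU}}}\right)f_{\theta_{\mathrm{LU}}}(\theta)\,\mathrm d\theta,$$ where $\gamma_{\mathrm{th}}$ is the predefined coverage threshold, $r_{\mathrm{LU}}(\theta)$ is the Euclidean distance between the associated leader satellite and the user when their central angle is $\theta$, $$r_{\mathrm{LU}}(\theta)=\sqrt{R_{\mathrm{sat}}^2+R_\oplus^2-2R_{\mathrm{sat}}R_\oplus\cos\theta},$$ and $f_{\theta_{\mathrm{LU}}}$ is the PDF of the contact angle $\theta_{\mathrm{LU}}$, $$f_{\theta_{\mathrm{LU}}}(\theta)=\frac{N_{\mathrm L}\sin\theta}{2}\left(\frac{1+\cos\theta}{2}\right)^{N_{\mathrm L}-1},\qquad 0\le\theta\le\theta_{\max}.$$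
   Context: Geometry: $R_\oplus>0$ is the Earth radius, $h_{\mathrm{sat}}>0$ the satellite altitude, $R_{\mathrm{sat}}=R_\oplus+h_{\mathrm{sat}}$. The user is a fixed point on the sphere of radius $R_\oplus$ centred at the Earth's centre $O$. $N_{\mathrm L}\ge1$ leader satellites are i.i.d. uniformly distributed on the sphere of radius $R_{\mathrm{sat}}$ centred at $O$ (homogeneous binomial point process). The central angle between two devices is the angle at $O$ between the segments joining $O$ to them. The associated leader is the leader nearest to the user, and the contact angle $\theta_{\mathrm{LU}}$ is the central angle between it and the user. $\theta_{\max}$ is the maximum central angle between a leader satellite and the user (corresponding to the maximum communication distance), with $\theta_{\max}\le\arccos(R_\oplus/R_{\mathrm{sat}})-\theta_{\mathrm{cap}}$ for a constant $\theta_{\mathrm{cap}}>0$ (the angular radius of the cap in which follower satellites would be placed). The contact angle is taken to range over $0\le\theta_{\mathrm{LU}}\le\theta_{\max}$, with the PDF $f_{\theta_{\mathrm{LU}}}$ displayed in the claim on that range. Channel: $\mathrm{SNR}_{\mathrm{LU}}=\xi_{\mathrm{LU}}W_{\mathrm U}/r_{\mathrm{LU}}^2$, where $r_{\mathrm{LU}}$ is the Euclidean distance between the associated leader and the user, and $\xi_{\mathrm{LU}}=\rho_{\mathrm{LU}}G_{\mathrm{LU}}\zeta_{\mathrm U}\left(\frac{\nu_{\mathrm{LU}}}{4\pi\sigma_{\mathrm U}}\right)^2$ is a positive constant (transmit power $\rho_{\mathrm{LU}}$, antenna gain $G_{\mathrm{LU}}$, rain attenuation $\zeta_{\mathrm U}$,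 wavelength $\nu_{\mathrm{LU}}$, noise power $\sigma_{\mathrm U}^2$). $W_{\mathrm U}\ge0$ is the shadowed-Rician fading power, independent of the satellite positions, with CDF (parameters $\Omega,b_0,m>0$) $$F_{W_{\mathrm U}}(w)=\left(\frac{2b_0m}{2b_0m+\Omega}\right)^m\sum_{z=0}^\infty\frac{(m)_z}{z!\,\Gamma(z+1)}\left(\frac{\Omega}{2b_0m+\Omega}\right)^z\int_0^{w/(2b_0)}t^ze^{-t}\,\mathrm dt,\quad w\ge0,$$ with $(m)_z$ the Pochhammer symbol. No follower satellite provides coverage in this statement.
   Formalization: The outage probability is taken as the probability that the contact angle is at most θ_max and SNR_LU < γ_th, without renormalising; the displayed PDF has total mass below 1 on [0, θ_max], so the formula fails for the unrestricted P(SNR_LU < γ_th). *)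

theory Defs
  imports "HOL-Probability.Probability"
begin

text \<open>
  The uniform distribution on the sphere of radius \<open>R\<close> about \<open>c\<close>: normalised surface
  area is the image of the uniform distribution on the solid unit ball under radial projection
  (a measurable part of the sphere gets the volume fraction of the cone over it). The lemmas
  below record that it is a rotation-invariant probability measure carried by the sphere, which
  determines it uniquely.
\<close>

definition uniform_sphere :: "real^3 \<Rightarrow> real \<Rightarrow> (real^3) measure" where
  "uniform_sphere c R =
     distr (uniform_measure lborel (ball 0 1)) borel (\<lambda>x. c + R *\<^sub>R sgn x)"

lemma sets_uniform_sphere [simp, measurable_cong]: "sets (uniform_sphere c R) = sets borel"
  by (simp add: uniform_sphere_def)

lemma space_uniform_sphere [simp]: "space (uniform_sphere c R) = UNIV"
  by (simp add: uniform_sphere_def)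

lemma measurable_radial_projection [measurable]:
  "(\<lambda>x :: real^3. c + R *\<^sub>R sgn x) \<in> borel_measurable borel"
  unfolding sgn_div_norm by measurable

lemma emeasure_unit_ball3:
  "emeasure lborel (ball 0 1 :: (real^3) set) \<noteq> 0"
  "emeasure lborel (ball 0 1 :: (real^3) set) \<noteq> \<infinity>"
proof -
  show "emeasure lborel (ball 0 1 :: (real^3) set) \<noteq> 0"
    using content_ball_pos[of 1 "0 :: real^3"] by (auto simp: measure_def)
  show "emeasure lborel (ball 0 1 :: (real^3) set) \<noteq> \<infinity>"
    using emeasure_bounded_finite[of "ball 0 1 :: (real^3) set"] by simp
qed

lemma prob_space_uniform_sphere: "prob_space (uniform_sphere c R)"
proof -
  interpret prob_space "uniform_measure lborel (ball 0 1 :: (real^3) set)"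
    by (rule prob_space_uniform_measure) (fact emeasure_unit_ball3)+
  show ?thesis
    unfolding uniform_sphere_def by (rule prob_space_distr) simp
qed

lemma AE_uniform_sphere:
  assumes "R > 0"
  shows "AE x in uniform_sphere c R. x \<in> sphere c R"
proof -
  have "AE x in lborel. x \<noteq> (0 :: real^3)"
    by (rule AE_lborel_singleton)
  then have "AE x in uniform_measure lborel (ball 0 1 :: (real^3) set).
               c + R *\<^sub>R sgn x \<in> sphere c R"
    using assms by (intro AE_uniform_measureI) (auto simp: dist_norm norm_sgn elim!: eventually_mono)
  then show ?thesis
    unfolding uniform_sphere_def by (subst AE_distr_iff) auto
qed

lemma uniform_sphere_orthogonal_invariant:
  assumes f: "orthogonal_transformation f"
  shows "distr (uniform_sphere c R) borel (\<lambda>x. c + f (x - c)) = uniform_sphere c R"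
proof -
  let ?B = "ball 0 1 :: (real^3) set"
  have lin: "linear f" and nrm: "\<And>x. norm (f x) = norm x"
    using f by (auto simp: orthogonal_transformation)
  have f_meas [measurable]: "f \<in> borel_measurable borel"
    by (intro borel_measurable_continuous_onI linear_continuous_on linear_linear[THEN iffD2] lin)
  obtain g where g: "orthogonal_transformation g" "\<And>x. f (g x) = x" "\<And>x. g (f x) = x"
    using orthogonal_transformation_bij[OF f] orthogonal_transformation_inv[OF f]
    by (metis bij_inv_eq_iff)
  have g_meas [measurable]: "g \<in> borel_measurable borel"
    by (intro borel_measurable_continuous_onI linear_continuous_on linear_linear[THEN iffD2]
          orthogonal_transformation_linear g)
  have g_nrm: "\<And>x. norm (g x) = norm x"
    using g(1) by (auto simp: orthogonal_transformation)
  have "distr (uniform_measure lborel ?B) borel f = uniform_measure lborel ?B"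
  proof (rule measure_eqI)
    fix A :: "(real^3) set" assume "A \<in> sets (distr (uniform_measure lborel ?B) borel f)"
    then have A [measurable]: "A \<in> sets borel" by simp
    have pre: "f -` A \<in> sets borel"
      using measurable_sets[OF f_meas A] by simp
    have eq: "?B \<inter> f -` A = g ` (?B \<inter> A)"
    proof (intro equalityI subsetI)
      fix x assume "x \<in> ?B \<inter> f -` A"
      then have "f x \<in> ?B \<inter> A" using nrm by simp
      then show "x \<in> g ` (?B \<inter> A)" using g(3)[of x] by (metis imageI)
    qed (use g(2) g_nrm in auto)
    have fin: "?B \<inter> A \<in> lmeasurable"
      by (rule fmeasurable_Int_fmeasurable) auto
    have fin': "?B \<inter> f -` A \<in> lmeasurable"
      using pre by (intro fmeasurable_Int_fmeasurable) auto
    have "measure lebesgue (?B \<inter> f -` A) = measure lebesgue (?B \<inter> A)"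
      unfolding eq by (rule measure_orthogonal_image[OF g(1) fin])
    then have "emeasure lebesgue (?B \<inter> f -` A) = emeasure lebesgue (?B \<inter> A)"
      using fin fin' by (simp add: emeasure_eq_measure2)
    then have "emeasure lborel (?B \<inter> f -` A) = emeasure lborel (?B \<inter> A)"
      using pre by simp
    then show "emeasure (distr (uniform_measure lborel ?B) borel f) A
                 = emeasure (uniform_measure lborel ?B) A"
      using pre by (simp add: emeasure_distr)
  qed simp
  then have "distr (distr (uniform_measure lborel ?B) borel f) borel (\<lambda>x. c + R *\<^sub>R sgn x)
      = uniform_sphere c R"
    by (simp add: uniform_sphere_def)
  moreover have "c + f (c + R *\<^sub>R sgn x - c) = c + R *\<^sub>R sgn (f x)" for x
    using nrm[of x] by (simp add: sgn_div_norm linear_cmul[OF lin])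
  ultimately show ?thesis
    unfolding uniform_sphere_def by (simp add: distr_distr comp_def)
qed

definition central_angle :: "real^3 \<Rightarrow> real^3 \<Rightarrow> real^3 \<Rightarrow> real" where
  "central_angle c a b = arccos (((a - c) \<bullet> (b - c)) / (norm (a - c) * norm (b - c)))"

text \<open>
  Leaders are \<open>X 0 \<omega>, \<dots>, X (N - 1) \<omega>\<close>. Ties for the nearest one have probability zero.
\<close>

definition associated_leader ::
    "real^3 \<Rightarrow> nat \<Rightarrow> (nat \<Rightarrow> 'w \<Rightarrow> real^3) \<Rightarrow> 'w \<Rightarrow> real^3" where
  "associated_leader u N X \<omega> = X (arg_min_on (\<lambda>i. dist (X i \<omega>) u) {..<N}) \<omega>"

definition contact_angle ::
    "real^3 \<Rightarrow> real^3 \<Rightarrow> nat \<Rightarrow> (nat \<Rightarrow> 'w \<Rightarrow> real^3) \<Rightarrow> 'w \<Rightarrow> real" where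
  "contact_angle c u N X \<omega> = central_angle c (associated_leader u N X \<omega>) u"

definition link_constant :: "real \<Rightarrow> real \<Rightarrow> real \<Rightarrow> real \<Rightarrow> real \<Rightarrow> real" where
  "link_constant \<rho> G \<zeta> \<nu> \<sigma> = \<rho> * G * \<zeta> * (\<nu> / (4 * pi * \<sigma>))\<^sup>2"

definition snr ::
    "real \<Rightarrow> real^3 \<Rightarrow> nat \<Rightarrow> (nat \<Rightarrow> 'w \<Rightarrow> real^3) \<Rightarrow> ('w \<Rightarrow> real) \<Rightarrow> 'w \<Rightarrow> real" where
  "snr \<xi> u N X W \<omega> = \<xi> * W \<omega> / (dist (associated_leader u N X \<omega>) u)\<^sup>2"

text \<open>
  For \<open>w < 0\<close> the range of integration is empty, so the value is \<open>0\<close>, as it should be for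
  the CDF of a nonnegative variable.
\<close>

definition shadowed_rician_cdf :: "real \<Rightarrow> real \<Rightarrow> real \<Rightarrow> real \<Rightarrow> real" where
  "shadowed_rician_cdf \<Omega> b0 m w =
     (2 * b0 * m / (2 * b0 * m + \<Omega>)) powr m *
     (\<Sum>z. pochhammer m z / (fact z * Gamma (real z + 1)) * (\<Omega> / (2 * b0 * m + \<Omega>)) ^ z *
          integral {0..w / (2 * b0)} (\<lambda>t. t ^ z * exp (- t)))"

definition leader_user_distance :: "real \<Rightarrow> real \<Rightarrow> real \<Rightarrow> real" where
  "leader_user_distance R_sat R_earth \<theta> =
     sqrt (R_sat\<^sup>2 + R_earth\<^sup>2 - 2 * R_sat * R_earth * cos \<theta>)"

definition contact_angle_pdf :: "nat \<Rightarrow> real \<Rightarrow> real" where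
  "contact_angle_pdf N \<theta> = real N * sin \<theta> / 2 * ((1 + cos \<theta>) / 2) ^ (N - 1)"

text \<open>
  The contact angle ranges over \<open>[0, \<theta>_max]\<close> only: a nearest leader beyond \<open>\<theta>_max\<close> is out of
  communication range, there is then no leader-user link, and the sample point does not count
  as an outage of the link. Without this restriction the contact angle ranges over \<open>[0, \<pi>]\<close>.
\<close>

definition in_range ::
    "'w measure \<Rightarrow> real^3 \<Rightarrow> real^3 \<Rightarrow> nat \<Rightarrow> (nat \<Rightarrow> 'w \<Rightarrow> real^3) \<Rightarrow> real \<Rightarrow> 'w set" where
  "in_range M c u N X \<theta>_max = {\<omega> \<in> space M. contact_angle c u N X \<omega> \<le> \<theta>_max}"

definition outage_probability ::
    "'w measure \<Rightarrow> real^3 \<Rightarrow> real^3 \<Rightarrow> nat \<Rightarrow> (nat \<Rightarrow> 'w \<Rightarrow> real^3) \<Rightarrow> ('w \<Rightarrow> real) \<Rightarrow>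
     real \<Rightarrow> real \<Rightarrow> real \<Rightarrow> real" where
  "outage_probability M c u N X W \<xi> \<theta>_max \<gamma> =
     measure M {\<omega> \<in> in_range M c u N X \<theta>_max. snr \<xi> u N X W \<omega> < \<gamma>}"

end

theory Submission
  imports Defs
begin

text \<open>
  Slicing a circular cone in the unit ball perpendicularly to its axis shows that a leader is
  within central angle \<open>\<theta> < \<pi>/2\<close> of the user with probability \<open>(1 - cos \<theta>)/2\<close>. The leader nearest
  in distance is also nearest in angle, so by independence the contact angle exceeds \<open>\<theta>\<close> with
  probability \<open>((1 + cos \<theta>)/2)^N\<close>, whose negative derivative is the density. Only angles below
  \<open>\<pi>/2\<close> matter, because \<open>\<theta>_max < arccos (R_earth / R_sat)\<close>.

  Conditioning the event \<open>W < \<gamma> r\<^sup>2/\<xi>\<close> on the contact angle gives the integral formula with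
  \<open>P(W < w)\<close> in place of the CDF \<open>P(W \<le> w)\<close>. No continuity of the CDF is needed: the two differ
  at countably many \<open>w\<close> only, and these are thresholds of countably many angles.
\<close>

section \<open>Volume of a circular sector of the unit ball\<close>

text \<open>For positive radius this is \<open>emeasure_cball_aux\<close>. The set for radius 0 lies
  in every ball of positive radius, and those volumes tend to 0. Radius 0 does occur below: the
  slices of the sector shrink to a point at heights 0 and 1.\<close>

lemma emeasure_PiM_cball:
  assumes "finite A" "A \<noteq> {}" "r \<ge> 0"
  shows "emeasure (Pi\<^sub>M A (\<lambda>_. lborel))
           ({f. sqrt (\<Sum>i\<in>A. (f i)\<^sup>2) \<le> r} \<inter> space (Pi\<^sub>M A (\<lambda>_. lborel))) =
         ennreal (unit_ball_vol (real (card A)) * r ^ card A)"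
proof (cases "r = 0")
  case True
  let ?B = "\<lambda>r. {f. sqrt (\<Sum>i\<in>A. (f i)\<^sup>2) \<le> r} \<inter> space (Pi\<^sub>M A (\<lambda>_. lborel :: real measure))"
  let ?v = "\<lambda>r. ennreal (unit_ball_vol (real (card A)) * r ^ card A)"
  have card: "card A \<noteq> 0" using assms by simp
  have lim: "(?v \<longlongrightarrow> ?v 0) (at_right 0)"
    by (intro tendsto_intros)
  have meas: "?B r \<in> sets (Pi\<^sub>M A (\<lambda>_. lborel))" for r
  proof -
    have "?B r = {f \<in> space (Pi\<^sub>M A (\<lambda>_. lborel)). sqrt (\<Sum>i\<in>A. (f i)\<^sup>2) \<le> r}"
      by auto
    also have "\<dots> \<in> sets (Pi\<^sub>M A (\<lambda>_. lborel))"
      by measurable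
    finally show ?thesis .
  qed
  have "emeasure (Pi\<^sub>M A (\<lambda>_. lborel)) (?B 0) \<le> ?v r'" if "r' > 0" for r'
    using emeasure_cball_aux[OF assms(1) that] that
    by (metis (no_types, lifting) Int_mono Collect_mono emeasure_mono meas order_trans less_imp_le order_refl)
  then have "emeasure (Pi\<^sub>M A (\<lambda>_. lborel)) (?B 0) \<le> ?v 0"
    by (intro tendsto_lowerbound[OF lim] eventually_mono[OF eventually_at_right_less]) auto
  with True card show ?thesis by (simp add: zero_power)
qed (use assms emeasure_cball_aux[of A r] in auto)

text \<open>
  The part of the unit ball making an angle of cosine at least \<open>t\<close> with the axis meets the plane at
  height \<open>z\<close> in a disc. Its squared radius is given by the cone for \<open>z \<le> t\<close> and by the ball for
  \<open>z \<ge> t\<close>.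
\<close>

lemma cone_slice_iff:
  fixes s t z :: real
  assumes "0 < t" "t \<le> 1" "0 \<le> s"
  shows "z\<^sup>2 + s \<le> 1 \<and> t * sqrt (z\<^sup>2 + s) \<le> z \<longleftrightarrow>
         z \<in> {0..1} \<and> s \<le> (if z \<le> t then z\<^sup>2 * (1 - t\<^sup>2) / t\<^sup>2 else 1 - z\<^sup>2)"
proof (cases "0 \<le> z")
  case False
  have "0 \<le> t * sqrt (z\<^sup>2 + s)" using assms by simp
  with False show ?thesis by auto
next
  case z: True
  have "t * sqrt (z\<^sup>2 + s) \<le> z \<longleftrightarrow> (t * sqrt (z\<^sup>2 + s))\<^sup>2 \<le> z\<^sup>2"
    using assms z by (intro power_mono_iff[symmetric]) auto
  also have "\<dots> \<longleftrightarrow> t\<^sup>2 * (z\<^sup>2 + s) \<le> z\<^sup>2"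
    using assms by (simp add: power_mult_distrib)
  also have "\<dots> \<longleftrightarrow> s \<le> z\<^sup>2 * (1 - t\<^sup>2) / t\<^sup>2"
    using assms by (simp add: field_simps)
  finally have 1: "t * sqrt (z\<^sup>2 + s) \<le> z \<longleftrightarrow> s \<le> z\<^sup>2 * (1 - t\<^sup>2) / t\<^sup>2" .
  \<comment> \<open>The gap between the bound from the ball and the bound from the cone has the sign
    of \<open>t\<^sup>2 - z\<^sup>2\<close>. Hence the case distinction on \<open>z \<le> t\<close>
    selects the smaller of the two bounds.\<close>
  have eq: "1 - z\<^sup>2 - z\<^sup>2 * (1 - t\<^sup>2) / t\<^sup>2 = (t\<^sup>2 - z\<^sup>2) / t\<^sup>2"
    using assms by (simp add: field_simps)
  have 2: "z\<^sup>2 * (1 - t\<^sup>2) / t\<^sup>2 \<le> 1 - z\<^sup>2 \<longleftrightarrow> z \<le> t"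
  proof -
    have "z\<^sup>2 * (1 - t\<^sup>2) / t\<^sup>2 \<le> 1 - z\<^sup>2 \<longleftrightarrow> 0 \<le> (t\<^sup>2 - z\<^sup>2) / t\<^sup>2"
      using eq by linarith
    also have "\<dots> \<longleftrightarrow> z \<le> t"
      using assms z by (simp add: zero_le_divide_iff abs_le_square_iff[symmetric])
    finally show ?thesis .
  qed
  have 3: "z\<^sup>2 \<le> 1 \<longleftrightarrow> z \<le> 1"
    using z by (simp add: abs_square_le_1)
  show ?thesis
    using z 1 2 3 assms by (cases "z \<le> t") auto
qed

text \<open>The integrand is the squared radius of the slice at height \<open>z\<close>, so
  \<open>pi\<close> times this value is the volume of the sector. The cone below height
  \<open>t\<close> and the spherical cap above it are integrated separately.\<close>

lemma has_integral_cone_slices: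
  fixes t :: real
  assumes "0 < t" "t \<le> 1"
  shows "((\<lambda>z. if z \<le> t then z\<^sup>2 * (1 - t\<^sup>2) / t\<^sup>2 else 1 - z\<^sup>2) has_integral 2 / 3 * (1 - t)) {0..1}"
proof -
  have "((\<lambda>z. z\<^sup>2) has_integral t^3 / 3 - 0^3 / 3) {0..t}"
    by (rule fundamental_theorem_of_calculus)
       (use assms in \<open>auto intro!: derivative_eq_intros simp: has_real_derivative_iff_has_vector_derivative[symmetric]\<close>)
  from has_integral_mult_left[OF this, of "(1 - t\<^sup>2) / t\<^sup>2"]
  have "((\<lambda>z. z\<^sup>2 * (1 - t\<^sup>2) / t\<^sup>2) has_integral t^3 / 3 * (1 - t\<^sup>2) / t\<^sup>2) {0..t}"
    by simp
  then have 1: "((\<lambda>z. if z \<le> t then z\<^sup>2 * (1 - t\<^sup>2) / t\<^sup>2 else 1 - z\<^sup>2)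
      has_integral t^3 / 3 * (1 - t\<^sup>2) / t\<^sup>2) {0..t}"
    by (auto intro: has_integral_eq[rotated])
  have "((\<lambda>z. 1 - z\<^sup>2) has_integral (1 - 1^3/3) - (t - t^3/3)) {t..1}"
    by (rule fundamental_theorem_of_calculus)
       (use assms in \<open>auto intro!: derivative_eq_intros simp: has_real_derivative_iff_has_vector_derivative[symmetric]\<close>)
  \<comment> \<open>On \<open>{t..1}\<close> the conditional takes its first branch at the single
    point \<open>z = t\<close> only.\<close>
  then have 2: "((\<lambda>z. if z \<le> t then z\<^sup>2 * (1 - t\<^sup>2) / t\<^sup>2 else 1 - z\<^sup>2)
      has_integral (1 - 1^3/3) - (t - t^3/3)) {t..1}"
    by (rule has_integral_spike_finite[of "{t}", rotated 2]) auto
  have eq: "t^3 / 3 * (1 - t\<^sup>2) / t\<^sup>2 + ((1 - 1^3/3) - (t - t^3/3)) = 2 / 3 * (1 - t)"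
    using assms by (simp add: field_simps power3_eq_cube power2_eq_square)
  show ?thesis
    using has_integral_combine[OF _ _ 1 2] assms unfolding eq by auto
qed

text \<open>Fubini in coordinates: the coordinate along \<open>k\<close> is the height
  \<open>z\<close>, and the other two range over a disc of area \<open>pi * q z\<close>. Taking the
  axis in \<open>Basis\<close> turns Lebesgue measure into a product with the height as one
  factor.\<close>

lemma emeasure_cball_cone:
  fixes k :: "'a :: euclidean_space"
  assumes dim: "DIM('a) = 3" and k: "k \<in> Basis" and t: "0 < t" "t \<le> 1"
  shows "emeasure lborel {x \<in> cball 0 1. t * norm x \<le> x \<bullet> k} = ennreal (2 * pi / 3 * (1 - t))"
proof -
  define A where "A = Basis - {k}"
  have card: "card A = 2"
    using dim k by (simp add: A_def card_Diff_singleton)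
  then have "A \<noteq> {}" by auto
  with card have A: "finite A" "A \<noteq> {}" "k \<notin> A" "Basis = insert k A" "card A = 2"
    using k by (auto simp: A_def)
  define q where "q z = (if z \<le> t then z\<^sup>2 * (1 - t\<^sup>2) / t\<^sup>2 else 1 - z\<^sup>2)" for z
  have q_nonneg: "0 \<le> q z" if "z \<in> {0..1}" for z
    using that t by (auto simp: q_def abs_square_le_1 intro!: divide_nonneg_nonneg mult_nonneg_nonneg)
  let ?P = "\<lambda>I. Pi\<^sub>M I (\<lambda>_::'a. lborel :: real measure)"
  define C where "C = {f. (f k)\<^sup>2 + (\<Sum>i\<in>A. (f i)\<^sup>2) \<le> 1 \<and>
      t * sqrt ((f k)\<^sup>2 + (\<Sum>i\<in>A. (f i)\<^sup>2)) \<le> f k} \<inter> space (?P (insert k A))"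
  have nrm: "norm (\<Sum>b\<in>Basis. f b *\<^sub>R b :: 'a) = sqrt ((f k)\<^sup>2 + (\<Sum>i\<in>A. (f i)\<^sup>2))" for f
  proof -
    have "norm (\<Sum>b\<in>Basis. f b *\<^sub>R b :: 'a) = sqrt (\<Sum>i\<in>Basis. (f i)\<^sup>2)"
      unfolding norm_eq_sqrt_inner by (subst euclidean_inner) (simp add: power2_eq_square)
    then show ?thesis using A(1,3) by (simp add: A(4))
  qed
  have C_meas [measurable]: "C \<in> sets (?P (insert k A))"
  proof -
    have "C = {f \<in> space (?P (insert k A)). (f k)\<^sup>2 + (\<Sum>i\<in>A. (f i)\<^sup>2) \<le> 1 \<and>
      t * sqrt ((f k)\<^sup>2 + (\<Sum>i\<in>A. (f i)\<^sup>2)) \<le> f k}"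
      by (auto simp: C_def)
    also have "\<dots> \<in> sets (?P (insert k A))"
    proof -
      have *: "{x \<in> space N. (z x)\<^sup>2 + s x \<le> 1 \<and> t * sqrt ((z x)\<^sup>2 + s x) \<le> z x} \<in> sets N"
        if [measurable]: "z \<in> borel_measurable N" "s \<in> borel_measurable N"
        for z s and N :: "('a \<Rightarrow> real) measure"
      proof -
        have "(\<lambda>x. sqrt ((z x)\<^sup>2 + s x)) \<in> borel_measurable N"
          by measurable
        then have "(\<lambda>x. t * sqrt ((z x)\<^sup>2 + s x)) \<in> borel_measurable N"
          by (rule borel_measurable_times[OF measurable_const, rotated]) simp
        then show ?thesis
          by (intro sets.sets_Collect_conj borel_measurable_le) measurable
      qed
      show ?thesis by (rule *) measurable
    qed
    finally show ?thesis .
  qed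
  interpret product_sigma_finite "\<lambda>_::'a. lborel :: real measure"
    by standard
  have "emeasure lborel {x \<in> cball 0 1. t * norm x \<le> x \<bullet> k} = emeasure (?P Basis)
      ((\<lambda>f. \<Sum>b\<in>Basis. f b *\<^sub>R b) -` {x \<in> cball 0 1. t * norm x \<le> x \<bullet> k} \<inter> space (?P Basis))"
    by (subst lborel_eq, subst emeasure_distr) auto
  also have "(\<lambda>f. \<Sum>b\<in>Basis. f b *\<^sub>R b) -` {x \<in> cball 0 1. t * norm x \<le> x \<bullet> k} \<inter> space (?P Basis) = C"
    using k by (auto simp: C_def nrm inner_sum_left_Basis A(4)[symmetric])
  also have "emeasure (?P Basis) C = (\<integral>\<^sup>+ f. indicator C f \<partial>?P (insert k A))"
    by (simp add: A(4))
  also have "\<dots> = (\<integral>\<^sup>+ z. \<integral>\<^sup>+ f. indicator C (f(k := z)) \<partial>?P A \<partial>lborel)"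
    by (rule product_nn_integral_insert_rev) (use A(1,3) C_meas in auto)
  \<comment> \<open>By \<open>cone_slice_iff\<close> the sector condition separates into a range for
    \<open>z\<close> and a disc of radius \<open>sqrt (q z)\<close> in the remaining
    coordinates.\<close>
  also have "\<dots> = (\<integral>\<^sup>+ z. \<integral>\<^sup>+ f. indicator {0..1} z *
      indicator ({f. sqrt (\<Sum>i\<in>A. (f i)\<^sup>2) \<le> sqrt (q z)} \<inter> space (?P A)) f \<partial>?P A \<partial>lborel)"
  proof (intro nn_integral_cong)
    fix z f assume f: "f \<in> space (?P A)"
    have sum: "(\<Sum>i\<in>A. ((f(k := z)) i)\<^sup>2) = (\<Sum>i\<in>A. (f i)\<^sup>2)"
      using A by (intro sum.cong) auto
    have sp: "f(k := z) \<in> space (?P (insert k A))"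
      using f by (auto simp: space_PiM PiE_def extensional_def)
    show "indicator C (f(k := z)) = (indicator {0..1} z *
      indicator ({f. sqrt (\<Sum>i\<in>A. (f i)\<^sup>2) \<le> sqrt (q z)} \<inter> space (?P A)) f :: ennreal)"
      using cone_slice_iff[OF t, of "\<Sum>i\<in>A. (f i)\<^sup>2" z] sp f
      unfolding C_def indicator_def Int_iff mem_Collect_eq sum q_def
      by (simp add: sum_nonneg)
  qed
  also have "\<dots> = (\<integral>\<^sup>+ z. indicator {0..1} z *
      emeasure (?P A) ({f. sqrt (\<Sum>i\<in>A. (f i)\<^sup>2) \<le> sqrt (q z)} \<inter> space (?P A)) \<partial>lborel)"
  proof (intro nn_integral_cong)
    fix z
    have "{f. sqrt (\<Sum>i\<in>A. (f i)\<^sup>2) \<le> sqrt (q z)} \<inter> space (?P A) =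
        {f \<in> space (?P A). sqrt (\<Sum>i\<in>A. (f i)\<^sup>2) \<le> sqrt (q z)}"
      by auto
    also have "\<dots> \<in> sets (?P A)" by measurable
    finally show "(\<integral>\<^sup>+ f. indicator {0..1} z *
      indicator ({f. sqrt (\<Sum>i\<in>A. (f i)\<^sup>2) \<le> sqrt (q z)} \<inter> space (?P A)) f \<partial>?P A) =
      indicator {0..1} z *
      emeasure (?P A) ({f. sqrt (\<Sum>i\<in>A. (f i)\<^sup>2) \<le> sqrt (q z)} \<inter> space (?P A))"
      by (subst nn_integral_cmult) auto
  qed
  also have "\<dots> = (\<integral>\<^sup>+ z. ennreal (indicator {0..1} z * (pi * q z)) \<partial>lborel)"
  proof (intro nn_integral_cong)
    fix z
    \<comment> \<open>Outside \<open>{0..1}\<close> both sides vanish, so \<open>q z\<close> has to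
      be nonnegative only on that interval.\<close>
    show "indicator {0..1} z * emeasure (?P A) ({f. sqrt (\<Sum>i\<in>A. (f i)\<^sup>2) \<le> sqrt (q z)} \<inter> space (?P A))
        = ennreal (indicator {0..1} z * (pi * q z))"
      using emeasure_PiM_cball[OF A(1,2), of "sqrt (q z)"] q_nonneg[of z] A(5)
      by (auto simp: indicator_def unit_ball_vol_2)
  qed
  also have "\<dots> = ennreal (2 * pi / 3 * (1 - t))"
  proof -
    have "((\<lambda>z. pi * q z) has_integral pi * (2 / 3 * (1 - t))) {0..1}"
      unfolding q_def by (rule has_integral_mult_right[OF has_integral_cone_slices[OF t]])
    then show ?thesis
      using q_nonneg by (subst nn_integral_has_integral_lebesgue) (auto simp: field_simps)
  qed
  finally show ?thesis .
qed

section \<open>Central angles and chord lengths\<close>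

text \<open>Cauchy-Schwarz; if one of the vectors is zero, the quotient is 0 by the convention for
  division by 0. So \<open>central_angle\<close> always applies \<open>arccos\<close> within its
  domain.\<close>

lemma abs_central_angle_cos_le_1:
  fixes x c u :: "'a :: real_inner"
  shows "\<bar>((x - c) \<bullet> (u - c)) / (norm (x - c) * norm (u - c))\<bar> \<le> 1"
  using Cauchy_Schwarz_ineq2[of "x - c" "u - c"] by (auto simp: divide_le_eq_1)

lemma cos_central_angle:
  "cos (central_angle c x u) = ((x - c) \<bullet> (u - c)) / (norm (x - c) * norm (u - c))"
  unfolding central_angle_def by (rule cos_arccos_abs[OF abs_central_angle_cos_le_1])

lemma central_angle_bounds: "central_angle c x u \<in> {0..pi}"
  using abs_central_angle_cos_le_1[of x c u] unfolding central_angle_def abs_le_iff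
  by (auto intro!: arccos_lbound arccos_ubound)

lemma borel_measurable_central_angle [measurable]:
  "(\<lambda>x. central_angle c x u) \<in> borel_measurable borel"
proof -
  \<comment> \<open>Clamping the argument to \<open>{-1..1}\<close> gives a function that is
    continuous on the whole line, and the clamp does not change the value for an actual central
    angle.\<close>
  have [measurable]: "(\<lambda>x. arccos (max (-1) (min 1 x))) \<in> borel_measurable borel"
    by (intro borel_measurable_continuous_onI continuous_intros) auto
  have "(\<lambda>x. central_angle c x u) =
      (\<lambda>x. arccos (max (-1) (min 1 (((x - c) \<bullet> (u - c)) / (norm (x - c) * norm (u - c))))))"
  proof
    fix x
    show "central_angle c x u =
        arccos (max (-1) (min 1 (((x - c) \<bullet> (u - c)) / (norm (x - c) * norm (u - c)))))"
      using abs_central_angle_cos_le_1[of x c u] unfolding central_angle_def abs_le_iff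
      by (simp add: min_absorb2 max_absorb2)
  qed
  then show ?thesis by simp
qed

lemma central_angle_le_iff:
  assumes "0 \<le> \<theta>" "\<theta> \<le> pi"
  shows "central_angle c x u \<le> \<theta> \<longleftrightarrow> cos \<theta> \<le> cos (central_angle c x u)"
  using central_angle_bounds[of c x u] assms by (auto simp: cos_mono_le_eq)

text \<open>This is the law of cosines.\<close>

lemma leader_user_distance_central_angle:
  assumes "x \<in> sphere c R" "u \<in> sphere c r"
  shows "leader_user_distance R r (central_angle c x u) = dist x u"
proof -
  have n: "norm (x - c) = R" "norm (u - c) = r"
    using assms by (auto simp: dist_norm norm_minus_commute)
  have "(dist x u)\<^sup>2 = (norm ((x - c) - (u - c)))\<^sup>2"
    by (simp add: dist_norm)
  also have "\<dots> = R\<^sup>2 + r\<^sup>2 - 2 * ((x - c) \<bullet> (u - c))"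
    by (simp add: power2_norm_eq_inner inner_diff inner_commute n[symmetric])
  also have "(x - c) \<bullet> (u - c) = R * r * cos (central_angle c x u)"
  \<comment> \<open>With a zero radius the quotient for the cosine cannot be multiplied out, but
    then both sides are 0.\<close>
  proof (cases "R = 0 \<or> r = 0")
    case True
    then show ?thesis using n by auto
  next
    case False
    then show ?thesis by (simp add: cos_central_angle n)
  qed
  finally show ?thesis
    unfolding leader_user_distance_def by (simp add: mult.assoc real_sqrt_unique)
qed

section \<open>Probability of a spherical cap\<close>

text \<open>An orthogonal map takes a basis vector to \<open>e\<close> and preserves volume. Passing
  from the closed to the open ball removes only part of the unit sphere, a null set.\<close>

lemma emeasure_unit_ball_cone:
  fixes e :: "real^3"
  assumes e: "norm e = 1" and t: "0 < t" "t \<le> 1"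
  shows "emeasure lborel {x \<in> ball 0 1. t * norm x \<le> x \<bullet> e} = ennreal (2 * pi / 3 * (1 - t))"
proof -
  obtain k :: "real^3" where k: "k \<in> Basis" using nonempty_Basis by blast
  then obtain f where f: "orthogonal_transformation f" "f k = e"
    using orthogonal_transformation_exists_1[of k e] e by auto
  let ?S = "{x \<in> cball 0 1. t * norm x \<le> x \<bullet> k}"
  have meas: "{x \<in> cball 0 1. t * norm x \<le> x \<bullet> v} \<in> sets borel" for v :: "real^3"
    by measurable
  have bnd: "{x \<in> cball 0 1. t * norm x \<le> x \<bullet> v} \<in> lmeasurable" for v :: "real^3"
    using meas[of v] by (intro bounded_set_imp_lmeasurable) (auto intro: bounded_subset[OF bounded_cball[of 0 1]])
  have img: "f ` ?S = {x \<in> cball 0 1. t * norm x \<le> x \<bullet> e}"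
  proof (intro equalityI subsetI)
    fix y assume y: "y \<in> {x \<in> cball 0 1. t * norm x \<le> x \<bullet> e}"
    obtain x where x: "y = f x"
      using orthogonal_transformation_surj[OF f(1)] by (metis surjD)
    then show "y \<in> f ` ?S"
      using y f by (auto simp: orthogonal_transformation_norm orthogonal_transformation_def)
  qed (use f in \<open>auto simp: orthogonal_transformation_norm orthogonal_transformation_def\<close>)
  have "measure lebesgue {x \<in> cball 0 1. t * norm x \<le> x \<bullet> e} = measure lebesgue ?S"
    unfolding img[symmetric] by (rule measure_orthogonal_image[OF f(1) bnd])
  then have "emeasure lebesgue {x \<in> cball 0 1. t * norm x \<le> x \<bullet> e} = emeasure lebesgue ?S"
    using bnd by (simp add: emeasure_eq_measure2)
  then have "emeasure lborel {x \<in> cball 0 1. t * norm x \<le> x \<bullet> e} = emeasure lborel ?S"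
    using meas by simp
  also have "\<dots> = ennreal (2 * pi / 3 * (1 - t))"
    by (rule emeasure_cball_cone) (use k t in auto)
  also have "emeasure lborel {x \<in> cball 0 1. t * norm x \<le> x \<bullet> e} =
      emeasure lborel {x \<in> ball 0 1. t * norm x \<le> x \<bullet> e}"
  proof (rule emeasure_eq_AE)
    have "sphere 0 1 \<in> null_sets (lborel :: (real^3) measure)"
      using negligible_sphere[of "0 :: real^3" 1] by (simp add: negligible_iff_null_sets null_sets_completion_iff)
    then show "AE x in lborel. x \<in> {x \<in> cball 0 1. t * norm x \<le> x \<bullet> e} \<longleftrightarrow>
        x \<in> {x \<in> ball 0 1. t * norm x \<le> x \<bullet> e}"
      by (rule AE_I') auto
  qed auto
  finally show ?thesis .
qed

text \<open>Under radial projection the cap pulls back to a sector of the unit ball with cosine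
  bound \<open>cos \<theta>\<close>. The probability is the ratio of its volume to the volume
  \<open>4 / 3 * pi\<close> of the ball.\<close>

lemma emeasure_uniform_sphere_cap:
  assumes "R > 0" "u \<noteq> c" "0 \<le> \<theta>" "\<theta> < pi / 2"
  shows "emeasure (uniform_sphere c R) {x. central_angle c x u \<le> \<theta>} = ennreal ((1 - cos \<theta>) / 2)"
proof -
  define e where "e = sgn (u - c)"
  have e: "norm e = 1" using assms by (simp add: e_def norm_sgn)
  \<comment> \<open>Here \<open>\<theta> < pi / 2\<close> enters: the sector formula requires a
    positive cosine.\<close>
  have cos: "0 < cos \<theta>" "cos \<theta> \<le> 1"
    using assms by (auto intro!: cos_gt_zero_pi)
  let ?B = "ball 0 1 :: (real^3) set"
  \<comment> \<open>The equivalence fails at the origin: it is projected to \<open>c\<close>, which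
    gets the angle \<open>arccos 0 = pi / 2 > \<theta>\<close>, while the cone inequality holds
    there trivially. One point is negligible.\<close>
  have cap: "central_angle c (c + R *\<^sub>R sgn y) u \<le> \<theta> \<longleftrightarrow> cos \<theta> * norm y \<le> y \<bullet> e" if "y \<noteq> 0" for y
  proof -
    have uc: "u - c = norm (u - c) *\<^sub>R e"
      using assms by (simp add: e_def sgn_div_norm)
    have "(R *\<^sub>R sgn y) \<bullet> (u - c) = R * norm (u - c) * (sgn y \<bullet> e)"
      by (subst uc) (simp only: inner_scaleR_left inner_scaleR_right mult_ac)
    moreover have "norm (sgn y) = 1"
      using assms that by (simp add: norm_sgn)
    moreover have "sgn y \<bullet> e = (y \<bullet> e) / norm y"
      by (simp add: sgn_div_norm divide_inverse_commute)
    ultimately have "cos (central_angle c (c + R *\<^sub>R sgn y) u) = (y \<bullet> e) / norm y"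
      using assms by (simp add: cos_central_angle)
    then show ?thesis
      using assms that by (subst central_angle_le_iff) (simp_all add: pos_le_divide_eq)
  qed
  have "emeasure (uniform_sphere c R) {x. central_angle c x u \<le> \<theta>} =
      emeasure (uniform_measure lborel ?B) {y. central_angle c (c + R *\<^sub>R sgn y) u \<le> \<theta>}"
    unfolding uniform_sphere_def by (subst emeasure_distr) (auto simp: vimage_def)
  also have "\<dots> = emeasure lborel (?B \<inter> {y. central_angle c (c + R *\<^sub>R sgn y) u \<le> \<theta>}) / emeasure lborel ?B"
    by (subst emeasure_uniform_measure) auto
  also have "emeasure lborel (?B \<inter> {y. central_angle c (c + R *\<^sub>R sgn y) u \<le> \<theta>}) =
      emeasure lborel {y \<in> ?B. cos \<theta> * norm y \<le> y \<bullet> e}"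
  proof (rule emeasure_eq_AE)
    show "AE x in lborel. x \<in> ?B \<inter> {y. central_angle c (c + R *\<^sub>R sgn y) u \<le> \<theta>} \<longleftrightarrow>
        x \<in> {y \<in> ?B. cos \<theta> * norm y \<le> y \<bullet> e}"
      using AE_lborel_singleton[of "0 :: real^3"] by eventually_elim (auto simp: cap)
  qed auto
  also have "\<dots> = ennreal (2 * pi / 3 * (1 - cos \<theta>))"
    by (rule emeasure_unit_ball_cone[OF e cos])
  also have "emeasure lborel ?B = ennreal (4 / 3 * pi)"
    by (subst emeasure_ball) (auto simp: unit_ball_vol_3)
  also have "ennreal (2 * pi / 3 * (1 - cos \<theta>)) / ennreal (4 / 3 * pi) = ennreal ((1 - cos \<theta>) / 2)"
    using cos by (subst divide_ennreal) (auto simp: field_simps)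
  finally show ?thesis .
qed

section \<open>The nearest leader and its central angle\<close>

text \<open>
  The choice between several nearest leaders only depends on the set of nearest indices, of which
  there are finitely many; this makes the choice measurable.
\<close>

lemma measurable_associated_leader:
  assumes N: "N \<ge> 1" and X: "\<And>i. i < N \<Longrightarrow> X i \<in> borel_measurable M"
  shows "associated_leader u N X \<in> borel_measurable M"
proof -
  define I where "I \<omega> = {i \<in> {..<N}. \<forall>j\<in>{..<N}. dist (X i \<omega>) u \<le> dist (X j \<omega>) u}" for \<omega>
  have I_ne: "I \<omega> \<noteq> {}" for \<omega>
    using ex_is_arg_min_if_finite[of "{..<N}" "\<lambda>i. dist (X i \<omega>) u"] N
    by (auto simp: I_def is_arg_min_linorder lessThan_empty_iff)
  have I_sub: "I \<omega> \<subseteq> {..<N}" for \<omega>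
    by (auto simp: I_def)
  have le: "{\<omega> \<in> space M. dist (X i \<omega>) u \<le> dist (X j \<omega>) u} \<in> sets M" if "i < N" "j < N" for i j
    using X[OF that(1)] X[OF that(2)] by measurable
  have min: "{\<omega> \<in> space M. \<forall>j\<in>{..<N}. dist (X i \<omega>) u \<le> dist (X j \<omega>) u} \<in> sets M" if "i < N" for i
    by (rule sets.sets_Collect_finite_All) (use le that in auto)
  have "I \<in> measurable M (count_space (Pow {..<N} - {{}}))"
  proof (subst measurable_count_space_eq2)
    show "finite (Pow {..<N} - {{}})" by simp
    show "I \<in> space M \<rightarrow> Pow {..<N} - {{}} \<and>
        (\<forall>S\<in>Pow {..<N} - {{}}. I -` {S} \<inter> space M \<in> sets M)"
    proof (intro conjI ballI)
      fix S assume S: "S \<in> Pow {..<N} - {{}}"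
      have "I -` {S} \<inter> space M =
          {\<omega> \<in> space M. \<forall>i\<in>{..<N}. i \<in> S \<longleftrightarrow> (\<forall>j\<in>{..<N}. dist (X i \<omega>) u \<le> dist (X j \<omega>) u)}"
        using S unfolding I_def by auto
      also have "\<dots> \<in> sets M"
      proof (rule sets.sets_Collect_finite_All)
        fix i assume "i \<in> {..<N}"
        then show "{\<omega> \<in> space M. i \<in> S \<longleftrightarrow> (\<forall>j\<in>{..<N}. dist (X i \<omega>) u \<le> dist (X j \<omega>) u)} \<in> sets M"
          using min[of i] sets.sets_Collect_neg[OF min[of i]] by (cases "i \<in> S") auto
      qed simp
      finally show "I -` {S} \<inter> space M \<in> sets M" .
    qed (use I_ne I_sub in auto)
  qed
  \<comment> \<open>For each fixed value \<open>S\<close> of \<open>I\<close> the chosen index is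
    constant, and \<open>I\<close> takes finitely many values.\<close>
  then have "(\<lambda>\<omega>. X (SOME i. i \<in> I \<omega>) \<omega>) \<in> borel_measurable M"
  proof (rule measurable_compose_countable'[rotated])
    fix S assume "S \<in> Pow {..<N} - {{}}"
    then have "(SOME i. i \<in> S) < N"
      by (metis Diff_iff PowD insertI1 lessThan_iff someI_ex subset_iff ex_in_conv)
    then show "X (SOME i. i \<in> S) \<in> borel_measurable M" by (rule X)
  qed (simp add: countable_finite)
  \<comment> \<open>Unfolding \<open>arg_min_on\<close> exposes a Hilbert choice whose predicate is
    membership in \<open>I \<omega>\<close>.\<close>
  then show ?thesis
    unfolding associated_leader_def arg_min_on_def arg_min_def is_arg_min_linorder I_def
    by (simp add: Ball_def cong: conj_cong)
qed

lemma measurable_contact_angle: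
  assumes "N \<ge> 1" "\<And>i. i < N \<Longrightarrow> X i \<in> borel_measurable M"
  shows "contact_angle c u N X \<in> borel_measurable M"
  unfolding contact_angle_def
  by (intro measurable_compose[OF measurable_associated_leader borel_measurable_central_angle] assms)

text \<open>By the law of cosines the squared distance is a decreasing affine function of the cosine
  of the angle, and the cosine decreases on \<open>{0..pi}\<close>.\<close>

lemma central_angle_mono_dist:
  assumes "x \<in> sphere c R" "y \<in> sphere c R" "u \<in> sphere c r" "R > 0" "r > 0"
    and "dist x u \<le> dist y u"
  shows "central_angle c x u \<le> central_angle c y u"
proof -
  have "R\<^sup>2 + r\<^sup>2 - 2 * R * r * cos (central_angle c x u) \<le> R\<^sup>2 + r\<^sup>2 - 2 * R * r * cos (central_angle c y u)"
    using assms(6) leader_user_distance_central_angle[OF assms(1,3)]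
      leader_user_distance_central_angle[OF assms(2,3)]
    by (metis leader_user_distance_def real_sqrt_le_iff)
  then have "(R * r) * cos (central_angle c y u) \<le> (R * r) * cos (central_angle c x u)"
    by simp
  then have "cos (central_angle c y u) \<le> cos (central_angle c x u)"
    using assms(4,5) by (subst (asm) mult_le_cancel_left_pos) auto
  then show ?thesis
    using central_angle_bounds[of c y u] by (subst central_angle_le_iff) auto
qed

lemma associated_leader_nearest:
  assumes "N \<ge> 1"
  obtains k where "k < N" "associated_leader u N X \<omega> = X k \<omega>"
    "\<And>i. i < N \<Longrightarrow> dist (X k \<omega>) u \<le> dist (X i \<omega>) u"
proof
  have fin: "finite {..<N}" "{..<N} \<noteq> {}" using assms by (auto simp: lessThan_empty_iff)
  let ?k = "arg_min_on (\<lambda>i. dist (X i \<omega>) u) {..<N}"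
  show "?k < N" using arg_min_if_finite(1)[OF fin] by simp
  show "dist (X ?k \<omega>) u \<le> dist (X i \<omega>) u" if "i < N" for i
    using arg_min_least[OF fin, of i "\<lambda>i. dist (X i \<omega>) u"] that by simp
qed (simp add: associated_leader_def)

text \<open>By monotonicity of the angle in the distance, the contact angle is the minimum of all
  leader angles, whichever of several nearest leaders is chosen.\<close>

lemma contact_angle_le_iff:
  assumes "N \<ge> 1" "\<And>i. i < N \<Longrightarrow> X i \<omega> \<in> sphere c R" "u \<in> sphere c r" "R > 0" "r > 0"
  shows "contact_angle c u N X \<omega> \<le> \<theta> \<longleftrightarrow> (\<exists>i<N. central_angle c (X i \<omega>) u \<le> \<theta>)"
proof -
  obtain k where k: "k < N" "associated_leader u N X \<omega> = X k \<omega>"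
    "\<And>i. i < N \<Longrightarrow> dist (X k \<omega>) u \<le> dist (X i \<omega>) u"
    using associated_leader_nearest[OF assms(1), where X = X and \<omega> = \<omega> and u = u] by blast
  have "central_angle c (X k \<omega>) u \<le> central_angle c (X i \<omega>) u" if "i < N" for i
    using assms k(1) k(3)[OF that] that by (intro central_angle_mono_dist[of _ c R _ _ r]) auto
  then show ?thesis
    unfolding contact_angle_def k(2) using k(1) by (auto intro: order_trans)
qed

section \<open>Distribution of the contact angle\<close>

text \<open>The laws of the leaders place them on the sphere only almost surely, whereas the
  geometric facts above need actual membership. This lemma bridges the two.\<close>

lemma (in prob_space) AE_leaders_on_sphere:
  fixes X :: "nat \<Rightarrow> 'a \<Rightarrow> real^3"
  assumes "R > 0" "\<And>i. i < N \<Longrightarrow> X i \<in> borel_measurable M"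
    "\<And>i. i < N \<Longrightarrow> distr M borel (X i) = uniform_sphere c R"
  shows "AE \<omega> in M. \<forall>i<N. X i \<omega> \<in> sphere c R"
proof -
  have "AE \<omega> in M. X i \<omega> \<in> sphere c R" if "i < N" for i
    using AE_uniform_sphere[OF assms(1), of c] assms(2)[OF that]
    unfolding assms(3)[OF that, symmetric] by (subst (asm) AE_distr_iff) auto
  then have "AE \<omega> in M. \<forall>i\<in>{..<N}. X i \<omega> \<in> sphere c R"
    by (intro AE_finite_allI) simp_all
  then show ?thesis by (simp only: Ball_def lessThan_iff)
qed

lemma (in prob_space) prob_contact_angle_le:
  assumes "R > 0" "r > 0" "u \<in> sphere c r" "N \<ge> 1"
    and indep: "indep_vars (\<lambda>_. borel) X {..<N}"
    and unif: "\<And>i. i < N \<Longrightarrow> distr M borel (X i) = uniform_sphere c R"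
    and \<theta>: "0 \<le> \<theta>" "\<theta> < pi / 2"
  shows "prob {\<omega> \<in> space M. contact_angle c u N X \<omega> \<le> \<theta>} = 1 - ((1 + cos \<theta>) / 2) ^ N"
proof -
  have X [measurable]: "X i \<in> borel_measurable M" if "i < N" for i
    using indep that by (auto simp: indep_vars_def)
  note [measurable] = measurable_contact_angle[OF \<open>N \<ge> 1\<close> X]
  have uc: "u \<noteq> c" using assms by auto
  let ?F = "{x. \<theta> < central_angle c x u}"
  have F: "?F \<in> sets borel" by measurable
  have one: "prob (X i -` ?F \<inter> space M) = (1 + cos \<theta>) / 2" if "i < N" for i
  proof -
    interpret U: prob_space "uniform_sphere c R" by (rule prob_space_uniform_sphere)
    have "prob (X i -` ?F \<inter> space M) = measure (distr M borel (X i)) ?F"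
      using that F by (simp add: measure_distr)
    also have "\<dots> = U.prob (UNIV - {x. central_angle c x u \<le> \<theta>})"
      unfolding unif[OF that] by (intro arg_cong[where f = U.prob]) auto
    also have "\<dots> = 1 - U.prob {x. central_angle c x u \<le> \<theta>}"
      using U.prob_compl[of "{x. central_angle c x u \<le> \<theta>}"] by simp
    also have "U.prob {x. central_angle c x u \<le> \<theta>} = (1 - cos \<theta>) / 2"
      using emeasure_uniform_sphere_cap[OF \<open>R > 0\<close> uc \<theta>] by (simp add: measure_def)
    finally show ?thesis by (simp add: field_simps)
  qed
  have "prob {\<omega> \<in> space M. contact_angle c u N X \<omega> \<le> \<theta>} =
      1 - prob {\<omega> \<in> space M. \<not> contact_angle c u N X \<omega> \<le> \<theta>}"
    by (subst prob_neg) auto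
  also have "prob {\<omega> \<in> space M. \<not> contact_angle c u N X \<omega> \<le> \<theta>} =
      prob (\<Inter>i\<in>{..<N}. X i -` ?F \<inter> space M)"
  \<comment> \<open>The contact angle exceeds \<open>\<theta>\<close> exactly when every leader lies
    outside the cap, provided that all leaders are on the sphere.\<close>
  proof (rule finite_measure_eq_AE)
    show "AE \<omega> in M. \<omega> \<in> {\<omega> \<in> space M. \<not> contact_angle c u N X \<omega> \<le> \<theta>} \<longleftrightarrow>
        \<omega> \<in> (\<Inter>i\<in>{..<N}. X i -` ?F \<inter> space M)"
      using AE_leaders_on_sphere[of R N X c, OF \<open>R > 0\<close> X unif, simplified] AE_space
    proof eventually_elim
      case (elim \<omega>)
      have "contact_angle c u N X \<omega> \<le> \<theta> \<longleftrightarrow> (\<exists>i<N. central_angle c (X i \<omega>) u \<le> \<theta>)"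
        using elim(1) by (intro contact_angle_le_iff[OF \<open>N \<ge> 1\<close> _ \<open>u \<in> sphere c r\<close> \<open>R > 0\<close> \<open>r > 0\<close>]) auto
      moreover have "\<omega> \<in> (\<Inter>i\<in>{..<N}. X i -` ?F \<inter> space M) \<longleftrightarrow> (\<forall>i<N. \<theta> < central_angle c (X i \<omega>) u)"
        using elim(2) by (simp only: INT_iff Int_iff vimage_eq mem_Collect_eq lessThan_iff Ball_def) blast
      ultimately show ?case
        using elim(2) by (metis (no_types, lifting) mem_Collect_eq not_le)
    qed
    show "(\<Inter>i\<in>{..<N}. X i -` ?F \<inter> space M) \<in> events"
      using \<open>N \<ge> 1\<close> F by (intro sets.finite_INT measurable_sets[OF X]) (auto simp: lessThan_empty_iff)
  qed auto
  also have "\<dots> = (\<Prod>i\<in>{..<N}. prob (X i -` ?F \<inter> space M))"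
    using \<open>N \<ge> 1\<close> F by (intro indep_varsD_finite[OF indep]) (auto simp: lessThan_empty_iff)
  also have "\<dots> = (\<Prod>i\<in>{..<N}. (1 + cos \<theta>) / 2)"
    by (intro prod.cong refl one) simp
  also have "\<dots> = ((1 + cos \<theta>) / 2) ^ N"
    by simp
  finally show ?thesis .
qed

text \<open>\<open>restrict_space\<close> does not renormalise, so the total mass of the density is
  the probability of being in range, in general less than 1. Both measures are finite on the rays
  \<open>{x<..}\<close> and agree there, which determines them.\<close>

lemma (in prob_space) distributed_contact_angle:
  assumes "R > 0" "r > 0" "u \<in> sphere c r" "N \<ge> 1"
    and indep: "indep_vars (\<lambda>_. borel) X {..<N}"
    and unif: "\<And>i. i < N \<Longrightarrow> distr M borel (X i) = uniform_sphere c R"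
    and \<theta>: "0 \<le> \<theta>_max" "\<theta>_max < pi / 2"
  shows "distributed (restrict_space M (in_range M c u N X \<theta>_max)) lborel (contact_angle c u N X)
           (\<lambda>\<theta>. ennreal (contact_angle_pdf N \<theta> * indicator {0..\<theta>_max} \<theta>))"
proof -
  have X: "X i \<in> borel_measurable M" if "i < N" for i
    using indep that by (auto simp: indep_vars_def)
  let ?T = "contact_angle c u N X"
  note T [measurable] = measurable_contact_angle[OF \<open>N \<ge> 1\<close> X]
  define F where "F \<theta> = 1 - ((1 + cos \<theta>) / 2) ^ N" for \<theta> :: real
  have prob_le: "prob {\<omega> \<in> space M. ?T \<omega> \<le> \<theta>} = F \<theta>" if "0 \<le> \<theta>" "\<theta> \<le> \<theta>_max" for \<theta>
    unfolding F_def using assms that by (intro prob_contact_angle_le) auto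
  have R_sets [measurable]: "in_range M c u N X \<theta>_max \<in> sets M"
    unfolding in_range_def by measurable
  let ?R = "restrict_space M (in_range M c u N X \<theta>_max)"
  have T_R [measurable]: "?T \<in> borel_measurable ?R"
    by (rule measurable_restrict_space1[OF T])
  have f_meas [measurable]: "contact_angle_pdf N \<in> borel_measurable borel"
    unfolding contact_angle_pdf_def by measurable
  have pos: "prob {\<omega> \<in> space M. x < ?T \<omega> \<and> ?T \<omega> \<le> \<theta>_max} = F \<theta>_max - F x"
    if "0 \<le> x" "x \<le> \<theta>_max" for x
  proof -
    have "prob {\<omega> \<in> space M. x < ?T \<omega> \<and> ?T \<omega> \<le> \<theta>_max} =
        prob ({\<omega> \<in> space M. ?T \<omega> \<le> \<theta>_max} - {\<omega> \<in> space M. ?T \<omega> \<le> x})"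
      by (intro arg_cong[where f = prob]) auto
    also have "\<dots> = F \<theta>_max - F x"
      using that by (subst finite_measure_Diff) (auto simp: prob_le)
    finally show ?thesis .
  qed
  \<comment> \<open>The formula for \<open>F\<close> covers nonnegative angles only. Almost sure
    positivity allows a negative left end \<open>x\<close> to be replaced by 0.\<close>
  have T_pos: "AE \<omega> in M. 0 < ?T \<omega>"
  proof -
    have "prob {\<omega> \<in> space M. ?T \<omega> \<le> 0} = 0"
      using prob_le[of 0] \<theta> by (simp add: F_def)
    then have "AE \<omega> in M. \<not> ?T \<omega> \<le> 0"
      by (subst (asm) prob_Collect_eq_0) auto
    then show ?thesis by (simp add: not_le)
  qed
  have "distr ?R lborel ?T = density lborel (\<lambda>\<theta>. ennreal (contact_angle_pdf N \<theta> * indicator {0..\<theta>_max} \<theta>))"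
  proof (rule measure_eqI_lessThan)
    fix x
    have dist: "emeasure (distr ?R lborel ?T) {x<..} = prob {\<omega> \<in> space M. x < ?T \<omega> \<and> ?T \<omega> \<le> \<theta>_max}"
    proof -
      have "emeasure (distr ?R lborel ?T) {x<..} = emeasure ?R (?T -` {x<..} \<inter> space ?R)"
        by (rule emeasure_distr) auto
      also have "?T -` {x<..} \<inter> space ?R = {\<omega> \<in> space M. x < ?T \<omega> \<and> ?T \<omega> \<le> \<theta>_max}"
        by (auto simp: space_restrict_space in_range_def)
      also have "emeasure ?R \<dots> = emeasure M \<dots>"
        by (rule emeasure_restrict_space) (auto simp: in_range_def)
      finally show ?thesis by (simp add: emeasure_eq_measure)
    qed
    then show "emeasure (distr ?R lborel ?T) {x<..} < \<infinity>" by simp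
    let ?a = "max 0 x"
    have dens: "emeasure (density lborel (\<lambda>\<theta>. ennreal (contact_angle_pdf N \<theta> * indicator {0..\<theta>_max} \<theta>))) {x<..}
        = (\<integral>\<^sup>+ \<theta>. ennreal (contact_angle_pdf N \<theta>) * indicator {?a..\<theta>_max} \<theta> \<partial>lborel)"
    proof (subst emeasure_density)
      show "(\<integral>\<^sup>+ \<theta>. ennreal (contact_angle_pdf N \<theta> * indicator {0..\<theta>_max} \<theta>) * indicator {x<..} \<theta> \<partial>lborel)
          = (\<integral>\<^sup>+ \<theta>. ennreal (contact_angle_pdf N \<theta>) * indicator {?a..\<theta>_max} \<theta> \<partial>lborel)"
        \<comment> \<open>The open ray and the closed interval may differ at the point
          \<open>x\<close>.\<close>
        using AE_lborel_singleton[of x]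
        by (intro nn_integral_cong_AE) (elim eventually_mono, auto split: split_indicator)
    qed auto
    show "emeasure (distr ?R lborel ?T) {x<..} =
        emeasure (density lborel (\<lambda>\<theta>. ennreal (contact_angle_pdf N \<theta> * indicator {0..\<theta>_max} \<theta>))) {x<..}"
    proof (cases "x \<le> \<theta>_max")
      case True
      have "prob {\<omega> \<in> space M. x < ?T \<omega> \<and> ?T \<omega> \<le> \<theta>_max} =
          prob {\<omega> \<in> space M. ?a < ?T \<omega> \<and> ?T \<omega> \<le> \<theta>_max}"
        by (rule finite_measure_eq_AE) (use T_pos in \<open>auto elim!: eventually_mono\<close>)
      also have "\<dots> = F \<theta>_max - F ?a"
        using True \<theta> by (intro pos) auto
      also have "ennreal \<dots> = (\<integral>\<^sup>+ \<theta>. ennreal (contact_angle_pdf N \<theta>) * indicator {?a..\<theta>_max} \<theta> \<partial>lborel)"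
      proof (rule nn_integral_FTC_Icc[symmetric])
        fix \<theta> assume t: "\<theta> \<in> {?a..\<theta>_max}"
        have "0 \<le> sin \<theta>" "0 \<le> 1 + cos \<theta>"
          using t \<open>\<theta>_max < pi / 2\<close> cos_ge_minus_one[of \<theta>] by (auto intro!: sin_ge_zero simp del: cos_ge_minus_one)
        then show "0 \<le> contact_angle_pdf N \<theta>"
          by (simp add: contact_angle_pdf_def)
        show "(F has_real_derivative contact_angle_pdf N \<theta>) (at \<theta>)"
          unfolding F_def contact_angle_pdf_def
          by (auto intro!: derivative_eq_intros)
      qed (use True \<theta> in auto)
      finally show ?thesis unfolding dist dens .
    next
      \<comment> \<open>A ray that starts beyond \<open>\<theta>_max\<close> has mass 0 under both
        measures.\<close>
      case False
      then have "{\<omega> \<in> space M. x < ?T \<omega> \<and> ?T \<omega> \<le> \<theta>_max} = {}" "{?a..\<theta>_max} = {}" by auto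
      then show ?thesis unfolding dist dens by (simp only: measure_empty) simp
    qed
  qed auto
  then show ?thesis
    unfolding distributed_def by auto
qed

section \<open>Fading power and its independence of the contact angle\<close>

text \<open>The range of integration is empty or a single point. This serves the case
  \<open>\<gamma> \<le> 0\<close>, in which the CDF is evaluated at nonpositive arguments.\<close>

lemma shadowed_rician_cdf_nonpos:
  assumes "w \<le> 0" "b0 > 0"
  shows "shadowed_rician_cdf \<Omega> b0 m w = 0"
proof -
  have "w / (2 * b0) \<le> 0" using assms by (simp add: divide_nonpos_pos)
  then have "integral {0..w / (2 * b0)} f = 0" for f :: "real \<Rightarrow> real"
    by (cases "w / (2 * b0) = 0") auto
  then show ?thesis by (simp add: shadowed_rician_cdf_def)
qed

text \<open>Only indices below \<open>N\<close> are compared, so the contact angle is a function of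
  the restricted tuple of leaders, the object in the independence hypothesis.\<close>

lemma contact_angle_restrict:
  "contact_angle c u N (\<lambda>i v. v i) (\<lambda>i\<in>{..<N}. X i \<omega>) = contact_angle c u N X \<omega>"
  if "N \<ge> 1"
proof -
  have "arg_min_on (\<lambda>i. dist ((\<lambda>i\<in>{..<N}. X i \<omega>) i) u) {..<N} = arg_min_on (\<lambda>i. dist (X i \<omega>) u) {..<N}"
    unfolding arg_min_on_def arg_min_def is_arg_min_def
    by (intro arg_cong[where f = Eps] ext) auto
  moreover have "arg_min_on (\<lambda>i. dist (X i \<omega>) u) {..<N} \<in> {..<N}"
    using that by (intro arg_min_if_finite) (auto simp: lessThan_empty_iff)
  ultimately show ?thesis
    unfolding contact_angle_def associated_leader_def by (simp add: restrict_apply')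
qed

text \<open>The contact angle is a measurable function of the tuple of leaders, so its events are
  among those already independent of \<open>W\<close>.\<close>

lemma (in prob_space) indep_var_fading_contact_angle:
  assumes "N \<ge> 1" and X: "\<And>i. i < N \<Longrightarrow> X i \<in> borel_measurable M" and W: "W \<in> borel_measurable M"
    and indep: "indep_set {W -` A \<inter> space M |A. A \<in> sets borel}
         {(\<lambda>\<omega>. \<lambda>i\<in>{..<N}. X i \<omega>) -` B \<inter> space M |B. B \<in> sets (PiM {..<N} (\<lambda>_. borel))}"
  shows "indep_var borel W borel (contact_angle c u N X)"
proof -
  let ?V = "\<lambda>\<omega>. \<lambda>i\<in>{..<N}. X i \<omega>" and ?P = "PiM {..<N} (\<lambda>_. borel :: (real^3) measure)"
  have V: "?V \<in> measurable M ?P"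
    by (rule measurable_restrict) (use X in auto)
  \<comment> \<open>\<open>indep_var_eq\<close> speaks of generated sigma-algebras; closure under
    intersection carries independence over from the preimage families.\<close>
  have stable: "Int_stable {f -` A \<inter> space M |A. A \<in> sets S}" for f :: "'a \<Rightarrow> 'x" and S
  proof (rule Int_stableI, safe)
    fix A B assume "A \<in> sets S" "B \<in> sets S"
    then show "\<exists>C. (f -` A \<inter> space M) \<inter> (f -` B \<inter> space M) = f -` C \<inter> space M \<and> C \<in> sets S"
      by (intro exI[of _ "A \<inter> B"]) auto
  qed
  let ?T = "contact_angle c u N X" and ?h = "contact_angle c u N (\<lambda>i v. v i)"
  have h: "?h \<in> borel_measurable ?P"
    using \<open>N \<ge> 1\<close> by (rule measurable_contact_angle) simp
  have sub: "{?T -` A \<inter> space M |A. A \<in> sets borel} \<subseteq> {?V -` B \<inter> space M |B. B \<in> sets ?P}"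
  proof safe
    fix A :: "real set" assume "A \<in> sets borel"
    then have "?h -` A \<inter> space ?P \<in> sets ?P" by (rule measurable_sets[OF h])
    moreover have "?T -` A \<inter> space M = ?V -` (?h -` A \<inter> space ?P) \<inter> space M"
      using measurable_space[OF V] contact_angle_restrict[OF \<open>N \<ge> 1\<close>, of c u X] by auto
    ultimately show "\<exists>B. ?T -` A \<inter> space M = ?V -` B \<inter> space M \<and> B \<in> sets ?P" by blast
  qed
  have "indep_set {W -` A \<inter> space M |A. A \<in> sets borel} {?T -` A \<inter> space M |A. A \<in> sets borel}"
    unfolding indep_set_def
    by (rule indep_sets_mono_sets[OF indep[unfolded indep_set_def]]) (use sub in \<open>simp split: bool.split\<close>)
  then show ?thesis
    unfolding indep_var_eq using W measurable_contact_angle[OF \<open>N \<ge> 1\<close> X] stable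
    by (auto intro!: indep_set_sigma_sets)
qed

section \<open>The outage probability as an integral\<close>

text \<open>
  The distance is injective in the angle, so a fixed positive multiple of its square meets the
  countably many atoms of a distribution only for countably many angles.
\<close>

lemma countable_leader_user_distance_atoms:
  assumes "finite_measure D" "R > 0" "r > 0" "k \<noteq> 0"
  shows "countable {\<theta> \<in> {0..pi}. measure D {k * (leader_user_distance R r \<theta>)\<^sup>2} \<noteq> 0}"
proof -
  let ?g = "\<lambda>\<theta>. k * (leader_user_distance R r \<theta>)\<^sup>2"
  \<comment> \<open>The radicand is at least \<open>(R - r)\<^sup>2\<close>, so squaring undoes the
    root.\<close>
  have sq: "(leader_user_distance R r \<theta>)\<^sup>2 = R\<^sup>2 + r\<^sup>2 - 2 * R * r * cos \<theta>" for \<theta>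
  proof -
    have "2 * R * r * cos \<theta> \<le> 2 * R * r * 1"
      using assms by (intro mult_left_mono) auto
    also have "\<dots> \<le> R\<^sup>2 + r\<^sup>2"
      using zero_le_power2[of "R - r"] by (simp add: power2_diff)
    finally show ?thesis by (simp add: leader_user_distance_def)
  qed
  have "inj_on ?g {0..pi}"
  proof (rule inj_onI)
    fix x y assume xy: "x \<in> {0..pi}" "y \<in> {0..pi}" "?g x = ?g y"
    then have "R * r * cos x = R * r * cos y"
      using assms by (simp add: sq)
    then have "cos x = cos y" using assms by simp
    then show "x = y" using xy by (auto intro: cos_inj_pi)
  qed
  moreover have "countable {x. measure D {x} \<noteq> 0}"
    by (rule finite_measure.countable_support[OF assms(1)])
  ultimately have "countable ({0..pi} \<inter> ?g -` {x. measure D {x} \<noteq> 0})"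
    by (intro countable_image_inj_Int_vimage)
  then show ?thesis by (rule countable_subset[rotated]) auto
qed

text \<open>The joint law of \<open>W\<close> and \<open>T\<close> is a product measure. Tonelli
  integrates out \<open>W\<close> first, for a fixed value of \<open>T\<close>.\<close>

lemma (in prob_space) emeasure_less_indep_var:
  fixes W T :: "'a \<Rightarrow> real" and g :: "real \<Rightarrow> real"
  assumes indep: "indep_var borel W borel T" and [measurable]: "g \<in> borel_measurable borel" "A \<in> sets borel"
  shows "emeasure M {\<omega> \<in> space M. T \<omega> \<in> A \<and> W \<omega> < g (T \<omega>)} =
    (\<integral>\<^sup>+ \<omega>. emeasure (distr M borel W) {..<g (T \<omega>)} * indicator A (T \<omega>) \<partial>M)"
proof -
  have [measurable]: "W \<in> borel_measurable M" "T \<in> borel_measurable M"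
    using indep_var_rv1[OF indep] indep_var_rv2[OF indep] by auto
  let ?W = "distr M borel W" and ?T = "distr M borel T"
  interpret W: prob_space ?W by (rule prob_space_distr) simp
  interpret T: prob_space ?T by (rule prob_space_distr) simp
  interpret WT: pair_sigma_finite ?W ?T ..
  let ?S = "{p :: real \<times> real. snd p \<in> A \<and> fst p < g (snd p)}"
  have S: "?S \<in> sets (borel \<Otimes>\<^sub>M borel)"
  proof -
    have "{p \<in> space (borel \<Otimes>\<^sub>M borel). snd p \<in> A \<and> fst p < g (snd p)} \<in> sets (borel \<Otimes>\<^sub>M borel)"
      by measurable
    then show ?thesis by (simp add: space_pair_measure)
  qed
  have S': "?S \<in> sets (?W \<Otimes>\<^sub>M ?T)"
    using S by (simp cong: sets_pair_measure_cong)
  have "emeasure M {\<omega> \<in> space M. T \<omega> \<in> A \<and> W \<omega> < g (T \<omega>)} =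
      emeasure (distr M (borel \<Otimes>\<^sub>M borel) (\<lambda>\<omega>. (W \<omega>, T \<omega>))) ?S"
    using S by (subst emeasure_distr) (auto intro!: arg_cong[where f = "emeasure M"])
  also have "distr M (borel \<Otimes>\<^sub>M borel) (\<lambda>\<omega>. (W \<omega>, T \<omega>)) = ?W \<Otimes>\<^sub>M ?T"
    using indep unfolding indep_var_distribution_eq by simp
  also have "emeasure (?W \<Otimes>\<^sub>M ?T) ?S = (\<integral>\<^sup>+ t. emeasure ?W ((\<lambda>w. (w, t)) -` ?S) \<partial>?T)"
    by (rule WT.emeasure_pair_measure_alt2[OF S'])
  also have "\<dots> = (\<integral>\<^sup>+ t. emeasure ?W {..<g t} * indicator A t \<partial>?T)"
    by (intro nn_integral_cong) (auto split: split_indicator intro!: arg_cong[where f = "emeasure ?W"])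
  also have "\<dots> = (\<integral>\<^sup>+ \<omega>. emeasure ?W {..<g (T \<omega>)} * indicator A (T \<omega>) \<partial>M)"
  proof -
    \<comment> \<open>A monotone function is Borel, so no regularity of the law of \<open>W\<close>
      is required.\<close>
    have "(\<lambda>x. measure ?W {..<x}) \<in> borel_measurable borel"
      by (rule borel_measurable_mono) (auto simp: mono_def intro!: W.finite_measure_mono)
    then have [measurable]: "(\<lambda>x. emeasure ?W {..<x}) \<in> borel_measurable borel"
      by (simp add: W.emeasure_eq_measure)
    have "(\<lambda>t. emeasure ?W {..<g t} * indicator A t) \<in> borel_measurable borel"
      by measurable
    then show ?thesis by (subst nn_integral_distr) auto
  qed
  finally show ?thesis .
qed

lemma (in prob_space) has_integral_outage_probability:
  assumes R: "R > r" "r > 0" and u: "u \<in> sphere c r" and N: "N \<ge> 1"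
    and indep: "indep_vars (\<lambda>_. borel) X {..<N}"
    and unif: "\<And>i. i < N \<Longrightarrow> distr M borel (X i) = uniform_sphere c R"
    and \<theta>: "0 \<le> \<theta>_max" "\<theta>_max < pi / 2"
    and \<xi>: "\<xi> > 0" and b0: "b0 > 0"
    and W: "W \<in> borel_measurable M" and W_nonneg: "AE \<omega> in M. W \<omega> \<ge> 0"
    and W_cdf: "\<And>w. w \<ge> 0 \<Longrightarrow> cdf (distr M borel W) w = shadowed_rician_cdf \<Omega> b0 m w"
    and W_indep: "indep_set {W -` A \<inter> space M |A. A \<in> sets borel}
         {(\<lambda>\<omega>. \<lambda>i\<in>{..<N}. X i \<omega>) -` B \<inter> space M |B. B \<in> sets (PiM {..<N} (\<lambda>_. borel))}"
  shows "((\<lambda>\<theta>. shadowed_rician_cdf \<Omega> b0 m (\<gamma> * (leader_user_distance R r \<theta>)\<^sup>2 / \<xi>)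
                 * contact_angle_pdf N \<theta>)
           has_integral outage_probability M c u N X W \<xi> \<theta>_max \<gamma>) {0..\<theta>_max}"
proof -
  have X: "X i \<in> borel_measurable M" if "i < N" for i
    using indep that by (auto simp: indep_vars_def)
  have "R > 0" using R by simp
  let ?T = "contact_angle c u N X" and ?W = "distr M borel W" and ?A = "in_range M c u N X \<theta>_max"
  define g where "g \<theta> = \<gamma> * (leader_user_distance R r \<theta>)\<^sup>2 / \<xi>" for \<theta>
  note [measurable] = W
  note T [measurable] = measurable_contact_angle[OF N X]
  have [measurable]: "g \<in> borel_measurable borel"
    unfolding g_def leader_user_distance_def by measurable
  have [measurable]: "contact_angle_pdf N \<in> borel_measurable borel"
    unfolding contact_angle_pdf_def by measurable
  have A_sets [measurable]: "?A \<in> sets M"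
    unfolding in_range_def by measurable
  interpret W: real_distribution ?W
    by (rule real_distribution_distr) simp
  \<comment> \<open>\<open>G\<close> is the CDF with strict inequality, matching the strict
    inequality in the outage event.\<close>
  define G where "G x = W.prob {..<x}" for x
  have G_mono: "mono G"
    by (auto simp: G_def mono_def intro!: W.finite_measure_mono)
  have [measurable]: "G \<in> borel_measurable borel"
    by (rule borel_measurable_mono[OF G_mono])
  have f_nonneg: "0 \<le> contact_angle_pdf N \<theta>" if "\<theta> \<in> {0..\<theta>_max}" for \<theta>
  proof -
    have "0 \<le> sin \<theta>" using that \<theta> by (auto intro!: sin_ge_zero)
    moreover have "0 \<le> 1 + cos \<theta>" using cos_ge_minus_one[of \<theta>] by linarith
    ultimately show ?thesis by (simp add: contact_angle_pdf_def)
  qed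
  have AE_snr: "AE \<omega> in M. snr \<xi> u N X W \<omega> < \<gamma> \<longleftrightarrow> W \<omega> < g (?T \<omega>)"
    using AE_leaders_on_sphere[of R N X c, OF \<open>R > 0\<close> X unif, simplified]
  proof eventually_elim
    case (elim \<omega>)
    obtain k where k: "k < N" "associated_leader u N X \<omega> = X k \<omega>"
      using associated_leader_nearest[OF N, where X = X and \<omega> = \<omega> and u = u] by blast
    have sph: "X k \<omega> \<in> sphere c R" using elim k by simp
    \<comment> \<open>Since \<open>R > r\<close>, leader and user cannot coincide, and the
      inequality for the SNR may be multiplied by the squared distance.\<close>
    then have "dist (X k \<omega>) u > 0" using u R by (auto simp: dist_commute)
    then show ?case
      unfolding g_def contact_angle_def snr_def k(2) leader_user_distance_central_angle[OF sph u]
      using \<xi> by (simp add: field_simps)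
  qed
  have "emeasure M {\<omega> \<in> ?A. snr \<xi> u N X W \<omega> < \<gamma>} =
      emeasure M {\<omega> \<in> space M. ?T \<omega> \<in> {..\<theta>_max} \<and> W \<omega> < g (?T \<omega>)}"
  proof (rule emeasure_eq_AE)
    show "AE \<omega> in M. \<omega> \<in> {\<omega> \<in> ?A. snr \<xi> u N X W \<omega> < \<gamma>} \<longleftrightarrow>
        \<omega> \<in> {\<omega> \<in> space M. ?T \<omega> \<in> {..\<theta>_max} \<and> W \<omega> < g (?T \<omega>)}"
      using AE_snr by eventually_elim (auto simp: in_range_def)
    have "(\<lambda>\<omega>. snr \<xi> u N X W \<omega>) \<in> borel_measurable M"
      unfolding snr_def using measurable_associated_leader[OF N X] by measurable
    then show "{\<omega> \<in> ?A. snr \<xi> u N X W \<omega> < \<gamma>} \<in> sets M"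
      unfolding in_range_def by measurable
  qed measurable
  also have "\<dots> = (\<integral>\<^sup>+ \<omega>. emeasure ?W {..<g (?T \<omega>)} * indicator {..\<theta>_max} (?T \<omega>) \<partial>M)"
    by (rule emeasure_less_indep_var[OF indep_var_fading_contact_angle[OF N X W W_indep]]) auto
  also have "\<dots> = (\<integral>\<^sup>+ \<omega>. ennreal (G (g (?T \<omega>))) * indicator ?A \<omega> \<partial>M)"
    by (intro nn_integral_cong) (auto simp: in_range_def G_def W.emeasure_eq_measure split: split_indicator)
  also have "\<dots> = (\<integral>\<^sup>+ \<omega>. ennreal (G (g (?T \<omega>))) \<partial>restrict_space M ?A)"
    by (subst nn_integral_restrict_space) auto
  also have "\<dots> = (\<integral>\<^sup>+ \<theta>. ennreal (contact_angle_pdf N \<theta> * indicator {0..\<theta>_max} \<theta>) * ennreal (G (g \<theta>)) \<partial>lborel)"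
    by (rule distributed_nn_integral[symmetric, OF distributed_contact_angle])
       (use \<open>R > 0\<close> R u N indep unif \<theta> in auto)
  also have "\<dots> = (\<integral>\<^sup>+ \<theta>. ennreal (indicator {0..\<theta>_max} \<theta> * (G (g \<theta>) * contact_angle_pdf N \<theta>)) \<partial>lborel)"
    using f_nonneg by (intro nn_integral_cong)
      (auto simp: G_def ennreal_mult'' mult.commute split: split_indicator)
  finally have out: "(\<integral>\<^sup>+ \<theta>. ennreal (indicator {0..\<theta>_max} \<theta> * (G (g \<theta>) * contact_angle_pdf N \<theta>)) \<partial>lborel) =
      ennreal (outage_probability M c u N X W \<xi> \<theta>_max \<gamma>)"
    by (simp add: outage_probability_def emeasure_eq_measure)
  have "((\<lambda>\<theta>. indicator {0..\<theta>_max} \<theta> * (G (g \<theta>) * contact_angle_pdf N \<theta>)) has_integral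
      outage_probability M c u N X W \<xi> \<theta>_max \<gamma>) UNIV"
  proof (rule nn_integral_has_integral[OF _ _ out])
    have "(\<lambda>\<theta>. G (g \<theta>)) \<in> borel_measurable borel" by measurable
    then show "(\<lambda>\<theta>. indicator {0..\<theta>_max} \<theta> * (G (g \<theta>) * contact_angle_pdf N \<theta>)) \<in> borel_measurable borel"
      by (intro borel_measurable_times) measurable
    show "0 \<le> indicator {0..\<theta>_max} \<theta> * (G (g \<theta>) * contact_angle_pdf N \<theta>)" for \<theta>
      using f_nonneg[of \<theta>] by (simp add: G_def split: split_indicator)
    show "0 \<le> outage_probability M c u N X W \<xi> \<theta>_max \<gamma>"
      by (simp add: outage_probability_def)
  qed
  moreover have "(\<lambda>\<theta>. indicator {0..\<theta>_max} \<theta> * (G (g \<theta>) * contact_angle_pdf N \<theta>)) =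
      (\<lambda>\<theta>. if \<theta> \<in> {0..\<theta>_max} then G (g \<theta>) * contact_angle_pdf N \<theta> else 0)"
    by (simp add: fun_eq_iff indicator_def)
  ultimately have G_int: "((\<lambda>\<theta>. G (g \<theta>) * contact_angle_pdf N \<theta>) has_integral
      outage_probability M c u N X W \<xi> \<theta>_max \<gamma>) {0..\<theta>_max}"
    by (simp only: has_integral_restrict_UNIV)
  \<comment> \<open>For \<open>\<gamma> > 0\<close> these are the angles whose threshold is an atom
    of \<open>W\<close>, where \<open>G\<close> and the CDF differ. For
    \<open>\<gamma> \<le> 0\<close> no exception arises, because both vanish at nonpositive
    thresholds.\<close>
  define Z where "Z = (if \<gamma> > 0 then {\<theta> \<in> {0..pi}. W.prob {g \<theta>} \<noteq> 0} else {})"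
  have "countable Z"
    using countable_leader_user_distance_atoms[of ?W R r "\<gamma> / \<xi>"] W.finite_measure_axioms \<open>R > 0\<close> R \<xi>
    by (auto simp: Z_def g_def)
  then have Z: "negligible Z"
    by (simp add: negligible_iff_null_sets countable_imp_null_set_lborel null_sets_completionI)
  have eq: "shadowed_rician_cdf \<Omega> b0 m (g \<theta>) * contact_angle_pdf N \<theta> = G (g \<theta>) * contact_angle_pdf N \<theta>"
    if "\<theta> \<in> {0..\<theta>_max} - Z" for \<theta>
  proof (cases "\<gamma> > 0")
    case True
    have "W.prob {g \<theta>} = 0" using that True \<theta> by (auto simp: Z_def)
    have "cdf ?W (g \<theta>) = W.prob ({..<g \<theta>} \<union> {g \<theta>})"
      unfolding cdf_def by (intro arg_cong[where f = W.prob]) auto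
    also have "\<dots> = G (g \<theta>) + W.prob {g \<theta>}"
      unfolding G_def by (rule W.finite_measure_Union) auto
    finally have "cdf ?W (g \<theta>) = G (g \<theta>)" using \<open>W.prob {g \<theta>} = 0\<close> by simp
    moreover have "0 \<le> g \<theta>" using True \<xi> by (simp add: g_def)
    ultimately show ?thesis using W_cdf by simp
  next
    case False
    have "\<gamma> * (leader_user_distance R r \<theta>)\<^sup>2 \<le> 0"
      using False by (intro mult_nonpos_nonneg) auto
    then have le: "g \<theta> \<le> 0" using \<xi> by (simp add: g_def divide_nonpos_pos)
    \<comment> \<open>\<open>G 0\<close> is the probability of \<open>W < 0\<close>, which is zero
      for a nonnegative fading power.\<close>
    have "G (g \<theta>) \<le> G 0" using le by (rule monoD[OF G_mono])
    also have "G 0 = prob {\<omega> \<in> space M. W \<omega> < 0}"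
      unfolding G_def by (subst measure_distr) (auto intro!: arg_cong[where f = prob])
    also have "\<dots> = 0"
      using W_nonneg by (subst prob_Collect_eq_0) (auto simp: not_less)
    finally have "G (g \<theta>) = 0" by (simp add: G_def order_antisym)
    then show ?thesis using le b0 by (simp add: shadowed_rician_cdf_nonpos)
  qed
  show ?thesis
    using has_integral_spike[OF Z eq G_int] unfolding g_def .
qed

text \<open>The first conjunct justifies calling \<open>contact_angle_pdf\<close> the density of the
  contact angle on its range. In the second, \<open>has_integral\<close> asserts that the integral
  exists as well as its value.\<close>

theorem theorem1:
  fixes M :: "'w measure"
    and c u :: "real^3"
    and R_earth h_sat R_sat \<theta>_max \<theta>_cap :: real
    and N :: nat
    and X :: "nat \<Rightarrow> 'w \<Rightarrow> real^3"
    and W :: "'w \<Rightarrow> real"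
    and \<Omega> b0 m \<rho> G \<zeta> \<nu> \<sigma> \<xi> \<gamma> :: real
  assumes prob: "prob_space M"
    and geometry: "R_earth > 0" "h_sat > 0" "R_sat = R_earth + h_sat"
    and user: "u \<in> sphere c R_earth"
    and leaders: "N \<ge> 1"
      "prob_space.indep_vars M (\<lambda>_. borel) X {..<N}"
      "\<And>i. i < N \<Longrightarrow> distr M borel (X i) = uniform_sphere c R_sat"
    and angles: "\<theta>_cap > 0" "0 \<le> \<theta>_max" "\<theta>_max \<le> arccos (R_earth / R_sat) - \<theta>_cap"
    and link: "\<rho> > 0" "G > 0" "\<zeta> > 0" "\<nu> > 0" "\<sigma> > 0" "\<xi> = link_constant \<rho> G \<zeta> \<nu> \<sigma>"
    and fading: "\<Omega> > 0" "b0 > 0" "m > 0"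
      "W \<in> borel_measurable M" "AE \<omega> in M. W \<omega> \<ge> 0"
      "\<And>w. w \<ge> 0 \<Longrightarrow> cdf (distr M borel W) w = shadowed_rician_cdf \<Omega> b0 m w"
    and fading_indep_leaders:
      "prob_space.indep_set M
         {W -` A \<inter> space M |A. A \<in> sets borel}
         {(\<lambda>\<omega>. \<lambda>i\<in>{..<N}. X i \<omega>) -` B \<inter> space M |B. B \<in> sets (PiM {..<N} (\<lambda>_. borel))}"
  shows "distributed (restrict_space M (in_range M c u N X \<theta>_max)) lborel (contact_angle c u N X)
           (\<lambda>\<theta>. ennreal (contact_angle_pdf N \<theta> * indicator {0..\<theta>_max} \<theta>))
       \<and> ((\<lambda>\<theta>. shadowed_rician_cdf \<Omega> b0 m (\<gamma> * (leader_user_distance R_sat R_earth \<theta>)\<^sup>2 / \<xi>)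
                 * contact_angle_pdf N \<theta>)
           has_integral outage_probability M c u N X W \<xi> \<theta>_max \<gamma>) {0..\<theta>_max}"
proof -
  interpret prob_space M by (rule prob)
  have R: "R_sat > R_earth" "R_sat > 0" using geometry by auto
  \<comment> \<open>The quotient of the radii is positive, so its arc cosine is at most
    \<open>pi / 2\<close>; subtracting \<open>\<theta>_cap > 0\<close> makes the bound on
    \<open>\<theta>_max\<close> strict.\<close>
  have "arccos (R_earth / R_sat) \<le> pi / 2"
    using R geometry arccos_le_arccos[of 0 "R_earth / R_sat"] by (simp add: arccos_0)
  then have \<theta>: "\<theta>_max < pi / 2" using angles by linarith
  have \<xi>: "\<xi> > 0"
    using link by (simp add: link_constant_def)
  show ?thesis
  proof
    show "distributed (restrict_space M (in_range M c u N X \<theta>_max)) lborel (contact_angle c u N X)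
        (\<lambda>\<theta>. ennreal (contact_angle_pdf N \<theta> * indicator {0..\<theta>_max} \<theta>))"
      by (rule distributed_contact_angle[OF R(2) geometry(1) user leaders angles(2) \<theta>])
    show "((\<lambda>\<theta>. shadowed_rician_cdf \<Omega> b0 m (\<gamma> * (leader_user_distance R_sat R_earth \<theta>)\<^sup>2 / \<xi>)
          * contact_angle_pdf N \<theta>) has_integral outage_probability M c u N X W \<xi> \<theta>_max \<gamma>) {0..\<theta>_max}"
      by (rule has_integral_outage_probability[OF R(1) geometry(1) user leaders angles(2) \<theta> \<xi>
            fading(2,4-6) fading_indep_leaders])
  qed
qed

end
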